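(* Let $Z(m,n)$ be the maximal number of cycles executed by the algorithm described in the context on $m\times n$ transportation problems. Then $$Z(m,n)\le \binom{m+n}{m}-1 .$$
   Context: Transportation problem of size $m\times n$: given integers $m,n\ge1$, real $a_i\ge 0$ ($1\le i\le m$), $b_j\ge 0$ ($1\le j\le n$) with $\sum_i a_i=\sum_j b_j$, and an arbitrary real matrix $(c_{ij})$, maximize $\sum_i\sum_j c_{ij}f_{ij}$ subject to $\sum_j f_{ij}=a_i$ for all $i$, $\sum_i f_{ij}=b_j$ for all $j$, $f_{ij}\ge0$. The maximum defining $Z(m,n)$ is taken over all such data for given $m,n$ and over all arbitrary choices made in the algorithm. Algorithm. It operates on a graph with the fixed set of $m+n+2$ nodes $A_1,\dots,A_m,B_1,\dots,B_n,P,Q$ and a varying set of edges, a variable real number $\alpha_i$ for each $A_i$, a variable real number $\beta_j$ for each $B_j$, and a variable real number called force for each edge. Put $\gamma_{ij}=\alpha_i-\beta_j-c_{ij}$. At the beginning of each cycle the graph is a forest consisting of two trees: the moving tree $T_m$, containing $Q$, and the fixed tree $T_f$, containing $P$. Step 1 (Initialize; executed once). The edges are: an edge between $Q$ and each $A_i$, with force $a_i$, and an edge between $P$ and each $B_j$, with force $b_j$. Set $\alpha_i=c_{\rm sup}$ for all $i$, where $c_{\rm sup}>\max_{i,j}c_{ij}$, and $\beta_j=0$ for all $j$. Then Steps 2 to 5 are repeated; each execution of Steps 2 to 5 is called a cycle. Step 2 (Descent). Compute $d=\min\{\gamma_{ij}: A_i\in T_m,\ B_j\in T_f\}$. Replace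 $\alpha_i$ by $\alpha_i-d$ for all $A_i\in T_m$ and $\beta_j$ by $\beta_j-d$ for all $B_j\in T_m$. Step 3 (Contact). Select a pair $(i_c,j_c)$ which realized the minimum $d$ in Step 2 (arbitrarily if there are several). Add an edge between $A_{i_c}$ and $B_{j_c}$ with force $0$. The graph is now a single tree. Step 4 (Readjustment). The main path is the unique path from $Q$ to $P$. Number its edges $1,2,3,\dots$ from $Q$ to $P$; it has an odd number of edges. Let $\lambda$ be the minimum of the forces of the odd-numbered edges. Add $\lambda$ to the forces of the even-numbered edges of the main path, and subtract $\lambda$ from the forces of its odd-numbered edges. Step 5 (Breaking). Select an odd-numbered edge of the main path which realized the minimum in Step 4 (arbitrarily if there are several) and delete it. The graph again consists of two trees, the new moving tree (containing $Q$) and the new fixed tree (containing $P$). If the moving tree contains $Q$ alone or the fixed tree contains $P$ alone, the algorithm terminates; otherwise go back to Step 2 for a new cycle. *)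

theory Defs
  imports Complex_Main "HOL-Library.Extended_Nat"
begin

text \<open>
  Indices run over \<open>{1..m}\<close> and \<open>{1..n}\<close>; values of \<open>a\<close>, \<open>b\<close>, \<open>c\<close>, \<open>alpha\<close>, \<open>beta\<close>
  outside these ranges are irrelevant. An edge is a two-element set of nodes.
\<close>

datatype node = ANode nat | BNode nat | PNode | QNode

definition transportation_data :: "nat \<Rightarrow> nat \<Rightarrow> (nat \<Rightarrow> real) \<Rightarrow> (nat \<Rightarrow> real) \<Rightarrow> bool" where
  "transportation_data m n a b \<longleftrightarrow>
     m \<ge> 1 \<and> n \<ge> 1 \<and>
     (\<forall>i\<in>{1..m}. 0 \<le> a i) \<and> (\<forall>j\<in>{1..n}. 0 \<le> b j) \<and>
     (\<Sum>i\<in>{1..m}. a i) = (\<Sum>j\<in>{1..n}. b j)"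

record state =
  edges :: "node set set"
  alpha :: "nat \<Rightarrow> real"
  beta  :: "nat \<Rightarrow> real"
  force :: "node set \<Rightarrow> real"  \<comment> \<open>meaningful on \<open>edges\<close> only\<close>

definition component :: "node set set \<Rightarrow> node \<Rightarrow> node set" where
  "component E u = {v. (u, v) \<in> {(x, y). {x, y} \<in> E}\<^sup>*}"

definition moving_tree :: "state \<Rightarrow> node set" where
  "moving_tree s = component (edges s) QNode"

definition fixed_tree :: "state \<Rightarrow> node set" where
  "fixed_tree s = component (edges s) PNode"

definition gamma :: "(nat \<Rightarrow> nat \<Rightarrow> real) \<Rightarrow> state \<Rightarrow> nat \<Rightarrow> nat \<Rightarrow> real" where
  "gamma c s i j = alpha s i - beta s j - c i j"

text \<open>Step 1; the number \<open>c_sup\<close> is an arbitrary choice.\<close>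

definition initial_state ::
  "nat \<Rightarrow> nat \<Rightarrow> (nat \<Rightarrow> real) \<Rightarrow> (nat \<Rightarrow> real) \<Rightarrow> (nat \<Rightarrow> nat \<Rightarrow> real) \<Rightarrow> state \<Rightarrow> bool" where
  "initial_state m n a b c s \<longleftrightarrow>
     edges s = {{QNode, ANode i} |i. i \<in> {1..m}} \<union> {{PNode, BNode j} |j. j \<in> {1..n}} \<and>
     (\<forall>i\<in>{1..m}. force s {QNode, ANode i} = a i) \<and>
     (\<forall>j\<in>{1..n}. force s {PNode, BNode j} = b j) \<and>
     (\<exists>c_sup. c_sup > Max {c i j |i j. i \<in> {1..m} \<and> j \<in> {1..n}} \<and>
              (\<forall>i\<in>{1..m}. alpha s i = c_sup)) \<and>
     (\<forall>j\<in>{1..n}. beta s j = 0)"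

text \<open>Step 2\<close>

definition contact_candidates :: "nat \<Rightarrow> nat \<Rightarrow> state \<Rightarrow> (nat \<times> nat) set" where
  "contact_candidates m n s =
     {(i, j). i \<in> {1..m} \<and> j \<in> {1..n} \<and> ANode i \<in> moving_tree s \<and> BNode j \<in> fixed_tree s}"

definition descent_amount :: "nat \<Rightarrow> nat \<Rightarrow> (nat \<Rightarrow> nat \<Rightarrow> real) \<Rightarrow> state \<Rightarrow> real" where
  "descent_amount m n c s = Min {gamma c s i j |i j. (i, j) \<in> contact_candidates m n s}"

definition descend :: "real \<Rightarrow> state \<Rightarrow> state" where
  "descend d s = s\<lparr>
     alpha := (\<lambda>i. if ANode i \<in> moving_tree s then alpha s i - d else alpha s i),
     beta  := (\<lambda>j. if BNode j \<in> moving_tree s then beta s j - d else beta s j)\<rparr>"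

text \<open>Step 3\<close>

definition contact :: "nat \<Rightarrow> nat \<Rightarrow> state \<Rightarrow> state" where
  "contact i j s = s\<lparr>
     edges := insert {ANode i, BNode j} (edges s),
     force := (force s)({ANode i, BNode j} := 0)\<rparr>"

text \<open>Step 4; a path is given by its list of nodes, and edge number \<open>k\<close>, counted from 1,
  joins the entries of the list at positions \<open>k - 1\<close> and \<open>k\<close>.\<close>

definition path_edge :: "node list \<Rightarrow> nat \<Rightarrow> node set" where
  "path_edge p k = {p ! (k - 1), p ! k}"

definition is_path :: "node set set \<Rightarrow> node \<Rightarrow> node \<Rightarrow> node list \<Rightarrow> bool" where
  "is_path E u v p \<longleftrightarrow>
     p \<noteq> [] \<and> hd p = u \<and> last p = v \<and> distinct p \<and>
     (\<forall>k. 1 \<le> k \<and> k < length p \<longrightarrow> path_edge p k \<in> E)"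

definition odd_edges :: "node list \<Rightarrow> node set set" where
  "odd_edges p = {path_edge p k |k. 1 \<le> k \<and> k < length p \<and> odd k}"

definition even_edges :: "node list \<Rightarrow> node set set" where
  "even_edges p = {path_edge p k |k. 1 \<le> k \<and> k < length p \<and> even k}"

definition min_odd_force :: "node list \<Rightarrow> state \<Rightarrow> real" where
  "min_odd_force p s = Min (force s ` odd_edges p)"

definition readjust :: "node list \<Rightarrow> real \<Rightarrow> state \<Rightarrow> state" where
  "readjust p l s = s\<lparr>force := (\<lambda>e.
     if e \<in> odd_edges p then force s e - l
     else if e \<in> even_edges p then force s e + l
     else force s e)\<rparr>"

text \<open>Step 5\<close>

definition delete_edge :: "node set \<Rightarrow> state \<Rightarrow> state" where
  "delete_edge e s = s\<lparr>edges := edges s - {e}\<rparr>"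

definition terminated :: "state \<Rightarrow> bool" where
  "terminated s \<longleftrightarrow> moving_tree s = {QNode} \<or> fixed_tree s = {PNode}"

text \<open>One cycle (Steps 2 to 5). After Step 3 the graph is a tree, so the path \<open>p\<close> is
  unique; the arbitrary choices are \<open>(i, j)\<close> and \<open>e\<close>.\<close>

definition transport_cycle ::
  "nat \<Rightarrow> nat \<Rightarrow> (nat \<Rightarrow> nat \<Rightarrow> real) \<Rightarrow> state \<Rightarrow> state \<Rightarrow> bool" where
  "transport_cycle m n c s s' \<longleftrightarrow>
     (\<exists>i j p e.
        let d = descent_amount m n c s;
            s1 = contact i j (descend d s);
            l = min_odd_force p s1
        in (i, j) \<in> contact_candidates m n s \<and> gamma c s i j = d \<and>
           is_path (edges s1) QNode PNode p \<and>
           e \<in> odd_edges p \<and> force s1 e = l \<and>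
           s' = delete_edge e (readjust p l s1))"

text \<open>A complete execution with exactly \<open>N\<close> cycles, where \<open>S k\<close> is the state after \<open>k\<close>
  cycles. Termination is tested only after a cycle, hence \<open>N \<ge> 1\<close>; the value \<open>N = \<infinity>\<close> stands
  for a run that never terminates.\<close>

definition execution ::
  "nat \<Rightarrow> nat \<Rightarrow> (nat \<Rightarrow> real) \<Rightarrow> (nat \<Rightarrow> real) \<Rightarrow> (nat \<Rightarrow> nat \<Rightarrow> real) \<Rightarrow>
   (nat \<Rightarrow> state) \<Rightarrow> enat \<Rightarrow> bool" where
  "execution m n a b c S N \<longleftrightarrow>
     initial_state m n a b c (S 0) \<and> N \<ge> 1 \<and>
     (\<forall>k. enat k < N \<longrightarrow> transport_cycle m n c (S k) (S (Suc k))) \<and>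
     (\<forall>k\<ge>1. enat k \<le> N \<longrightarrow> (terminated (S k) \<longleftrightarrow> enat k = N))"

text \<open>The supremum in \<^typ>\<open>enat\<close> of a nonempty set is a maximum as soon as it is finite, so no
  termination claim is built into this definition.\<close>

definition Z :: "nat \<Rightarrow> nat \<Rightarrow> enat" where
  "Z m n = Sup {N. \<exists>a b c S. transportation_data m n a b \<and> execution m n a b c S N}"

end

theory Submission
  imports Defs
begin

text \<open>
  The bound is a fact about the edges alone. Call the \<open>ANode i\<close> and \<open>PNode\<close> left, the \<open>BNode j\<close>
  and \<open>QNode\<close> right; every edge joins a left node to a right one. A cycle adds an edge whose left
  end lies in the moving tree and deletes an edge whose left end lies in the new fixed tree,
  because the deleted edge has an odd number on the path (\<open>transport_cycle_pivot\<close>). Thus a node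
  \<open>ANode i\<close> can only gain edges while it stays in the moving tree.

  Let \<open>T k\<close> be the tree present after the contact in cycle \<open>k\<close>. For \<open>k < l\<close> the trees \<open>T k\<close> and
  \<open>T l\<close> differ in the degree of some \<open>ANode i\<close> (\<open>pivot_degree_less\<close>). Indeed, let \<open>K\<close> be the
  component of \<open>QNode\<close> formed by the edges common to all forests in between; it is contained in the
  moving tree all the time. Since \<open>T l\<close> is connected, one of its edges leaves \<open>K\<close>, and by the choice
  of \<open>K\<close> this edge was created in between. When it was created its right end lay in the
  fixed tree, so the end in \<open>K\<close> is the left one, some \<open>ANode i\<close>. This node stays in the moving tree,
  gains an edge and loses none.

  So the number of cycles is at most the number of degree vectors of the left nodes. These are
  \<open>m + 1\<close> positive numbers with sum \<open>m + n + 1\<close>, the number of edges of a tree on \<open>m + n + 2\<close> nodes,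
  and there are \<open>(m + n) choose m\<close> such vectors. One of them never occurs: the \<open>ANode i\<close> that has just
  been joined to the fixed tree was already attached to the moving tree, so not all \<open>ANode i\<close>
  have degree 1.
\<close>

section \<open>Connected components of edge sets\<close>

lemma component_refl: "u \<in> component E u"
  by (simp add: component_def)

lemma component_step:
  assumes "x \<in> component E u" "{x, y} \<in> E"
  shows "y \<in> component E u"
  using assms unfolding component_def by (auto intro: rtrancl_into_rtrancl)

lemma component_closed:
  assumes "v \<in> component E u" "u \<in> S" "\<And>x y. x \<in> S \<Longrightarrow> {x, y} \<in> E \<Longrightarrow> y \<in> S"
  shows "v \<in> S"
proof -
  have "(u, v) \<in> {(x, y). {x, y} \<in> E}\<^sup>*"
    using assms(1) by (simp add: component_def)
  then show ?thesis
    by induction (use assms in auto)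
qed

lemma component_mono:
  assumes "E \<subseteq> F"
  shows "component E u \<subseteq> component F u"
proof
  fix v assume "v \<in> component E u"
  then show "v \<in> component F u"
    by (rule component_closed) (use assms component_refl component_step in blast)+
qed

lemma component_trans:
  assumes "v \<in> component E u" "w \<in> component E v"
  shows "w \<in> component E u"
  using assms(2,1) by (rule component_closed) (rule component_step)

lemma component_sym:
  assumes "v \<in> component E u"
  shows "u \<in> component E v"
proof -
  have "sym {(x, y). {x, y} \<in> E}"
    by (auto simp: sym_def insert_commute)
  then show ?thesis
    using assms unfolding component_def by (auto dest: sym_rtrancl symD)
qed

lemma component_exit:
  assumes "v \<in> component E u" "u \<in> S" "v \<notin> S"
  obtains x y where "x \<in> S" "y \<notin> S" "{x, y} \<in> E" "x \<in> component E u"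
proof -
  have "v \<in> S \<inter> component E u" if "\<And>x y. x \<in> S \<Longrightarrow> {x, y} \<in> E \<Longrightarrow> x \<in> component E u \<Longrightarrow> y \<in> S"
    using assms(1)
    by (rule component_closed) (use assms(2) that component_refl component_step in blast)+
  with assms(3) that show thesis by blast
qed

text \<open>A component is exhausted by adding one node at a time; each new node comes with an edge
  that reaches outside the nodes collected before and is therefore itself new.\<close>

lemma card_le_card_edges:
  assumes "finite E" "finite V" "V \<subseteq> component E u"
  shows "card V \<le> card E + 1"
proof -
  have grow: "\<exists>R F. finite R \<and> card R = Suc k \<and> u \<in> R \<and> R \<subseteq> component E u \<and>
      F \<subseteq> E \<and> card F = k \<and> \<Union>F \<subseteq> R" if "k < card V" for k
    using that
  proof (induction k)
    case 0
    show ?case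
      by (rule exI[of _ "{u}"], rule exI[of _ "{}"]) (auto simp: component_refl)
  next
    case (Suc k)
    then obtain R F where RF: "finite R" "card R = Suc k" "u \<in> R" "R \<subseteq> component E u"
      "F \<subseteq> E" "card F = k" "\<Union>F \<subseteq> R" by auto
    have "\<not> V \<subseteq> R"
      using card_mono[OF RF(1), of V] RF(2) Suc.prems by linarith
    then obtain v where "v \<in> component E u" "v \<notin> R"
      using assms(3) by blast
    then obtain x y where xy: "x \<in> R" "y \<notin> R" "{x, y} \<in> E"
      using RF(3) by (metis component_exit)
    have "{x, y} \<notin> F" using RF(7) xy(2) by blast
    moreover have "finite F" using RF(5) assms(1) finite_subset by blast
    ultimately have "card (insert {x, y} F) = Suc k" using RF(6) by simp
    moreover have "y \<in> component E u" using RF(4) xy component_step by blast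
    ultimately show ?case
      using RF xy by (intro exI[of _ "insert y R"] exI[of _ "insert {x, y} F"]) auto
  qed
  show ?thesis
  proof (cases "card V")
    case (Suc k)
    then obtain F where "F \<subseteq> E" "card F = k" using grow[of k] by auto
    then show ?thesis using card_mono[OF assms(1)] Suc by force
  qed simp
qed

section \<open>The evolution of the edge set\<close>

definition left_nodes :: "nat \<Rightarrow> node set" where
  "left_nodes m = ANode ` {1..m} \<union> {PNode}"

definition right_nodes :: "nat \<Rightarrow> node set" where
  "right_nodes n = BNode ` {1..n} \<union> {QNode}"

definition bipartite_edges :: "nat \<Rightarrow> nat \<Rightarrow> node set set" where
  "bipartite_edges m n = {{x, y} |x y. x \<in> left_nodes m \<and> y \<in> right_nodes n}"

lemma bipartite_edgesI: "x \<in> left_nodes m \<Longrightarrow> y \<in> right_nodes n \<Longrightarrow> {x, y} \<in> bipartite_edges m n"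
  by (auto simp: bipartite_edges_def)

lemma ANode_left: "i \<in> {1..m} \<Longrightarrow> ANode i \<in> left_nodes m"
  by (simp add: left_nodes_def)

lemma BNode_right: "j \<in> {1..n} \<Longrightarrow> BNode j \<in> right_nodes n"
  by (simp add: right_nodes_def)

lemma left_right_disjoint: "x \<in> left_nodes m \<Longrightarrow> x \<notin> right_nodes n"
  by (auto simp: left_nodes_def right_nodes_def)

text \<open>Acyclicity and the separation of \<open>PNode\<close> from \<open>QNode\<close> are encoded by the number of edges.
  A count is trivially maintained by adding one edge and deleting another.\<close>

definition two_trees :: "nat \<Rightarrow> nat \<Rightarrow> node set set \<Rightarrow> bool" where
  "two_trees m n E \<longleftrightarrow> finite E \<and> card E = m + n \<and> E \<subseteq> bipartite_edges m n \<and>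
     left_nodes m \<union> right_nodes n \<subseteq> component E QNode \<union> component E PNode"

text \<open>If the two trees met, then \<open>m + n\<close> edges would connect all \<open>m + n + 2\<close> nodes, one edge too few.\<close>

lemma two_trees_disjoint:
  assumes "two_trees m n E"
  shows "component E QNode \<inter> component E PNode = {}"
proof (rule ccontr)
  assume "component E QNode \<inter> component E PNode \<noteq> {}"
  then have "PNode \<in> component E QNode"
    using component_sym component_trans by blast
  then have "left_nodes m \<union> right_nodes n \<subseteq> component E QNode"
    using assms component_trans unfolding two_trees_def by blast
  moreover have "card (left_nodes m \<union> right_nodes n) = m + n + 2"
  proof -
    have "card (left_nodes m) = m + 1" "card (right_nodes n) = n + 1"
      by (simp_all add: left_nodes_def right_nodes_def card_image inj_on_def card_insert_if image_iff)
    moreover have "left_nodes m \<inter> right_nodes n = {}"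
      using left_right_disjoint by blast
    ultimately show ?thesis
      by (subst card_Un_disjoint) (auto simp: left_nodes_def right_nodes_def)
  qed
  ultimately show False
    using card_le_card_edges[of E "left_nodes m \<union> right_nodes n" QNode] assms
    by (auto simp: two_trees_def left_nodes_def right_nodes_def)
qed

text \<open>The trace of a cycle on the graph, with \<open>T\<close> the tree after the contact. The orientation is the
  point: the new edge has its left end in the moving tree, whereas the deleted edge has its left
  end in the fixed tree of the new forest \<open>E'\<close>.\<close>

definition pivot :: "nat \<Rightarrow> nat \<Rightarrow> node set set \<Rightarrow> node set set \<Rightarrow> node set set \<Rightarrow> bool" where
  "pivot m n E T E' \<longleftrightarrow>
     (\<exists>i\<in>{1..m}. \<exists>j\<in>{1..n}. ANode i \<in> component E QNode \<and> BNode j \<in> component E PNode \<and>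
        T = insert {ANode i, BNode j} E) \<and>
     (\<exists>x\<in>right_nodes n. \<exists>y\<in>left_nodes m. {x, y} \<in> T \<and> E' = T - {{x, y}} \<and>
        x \<in> component E' QNode \<and> y \<in> component E' PNode)"

lemma pivot_contact:
  assumes "two_trees m n E" "pivot m n E T E'"
  obtains i j where "i \<in> {1..m}" "j \<in> {1..n}" "ANode i \<in> component E QNode"
    "BNode j \<in> component E PNode" "T = insert {ANode i, BNode j} E" "{ANode i, BNode j} \<notin> E"
proof -
  from assms(2) obtain i j where ij: "i \<in> {1..m}" "j \<in> {1..n}" "ANode i \<in> component E QNode"
    "BNode j \<in> component E PNode" "T = insert {ANode i, BNode j} E" by (auto simp: pivot_def)
  moreover have "{ANode i, BNode j} \<notin> E"
    using ij two_trees_disjoint[OF assms(1)] component_step by blast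
  ultimately show thesis by (rule that)
qed

lemma pivot_subset_bipartite:
  assumes "two_trees m n E" "pivot m n E T E'"
  shows "T \<subseteq> bipartite_edges m n"
proof -
  obtain i j where "i \<in> {1..m}" "j \<in> {1..n}" "T = insert {ANode i, BNode j} E"
    by (rule pivot_contact[OF assms])
  then show ?thesis
    using assms(1) bipartite_edgesI[OF ANode_left BNode_right] by (simp add: two_trees_def)
qed

lemma pivot_connected:
  assumes "two_trees m n E" "pivot m n E T E'"
  shows "left_nodes m \<union> right_nodes n \<subseteq> component T QNode"
proof -
  obtain i j where ij: "ANode i \<in> component E QNode" "BNode j \<in> component E PNode"
    "T = insert {ANode i, BNode j} E" by (rule pivot_contact[OF assms])
  have mono: "component E u \<subseteq> component T u" for u
    using ij(3) by (intro component_mono) auto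
  have "BNode j \<in> component T QNode"
    using ij mono component_step[of "ANode i" T QNode "BNode j"] by blast
  then have "PNode \<in> component T QNode"
    using ij(2) mono component_sym component_trans by blast
  then show ?thesis
    using assms(1) mono component_trans unfolding two_trees_def by blast
qed

lemma pivot_card:
  assumes "two_trees m n E" "pivot m n E T E'"
  shows "finite T" "card T = m + n + 1"
proof -
  obtain i j where "T = insert {ANode i, BNode j} E" "{ANode i, BNode j} \<notin> E"
    by (rule pivot_contact[OF assms])
  with assms(1) show "finite T" "card T = m + n + 1"
    by (auto simp: two_trees_def)
qed

text \<open>Deleting an edge cuts off no third component, because the ends of that edge remain
  connected to \<open>QNode\<close> and to \<open>PNode\<close>.\<close>

lemma two_trees_pivot:
  assumes "two_trees m n E" "pivot m n E T E'"
  shows "two_trees m n E'"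
proof -
  from assms(2) obtain x y where xy: "{x, y} \<in> T" "E' = T - {{x, y}}"
    "x \<in> component E' QNode" "y \<in> component E' PNode" by (auto simp: pivot_def)
  have "v \<in> component E' QNode \<union> component E' PNode" if "v \<in> component T QNode" for v
    using that
  proof (rule component_closed)
    fix a b assume ab: "a \<in> component E' QNode \<union> component E' PNode" "{a, b} \<in> T"
    show "b \<in> component E' QNode \<union> component E' PNode"
    proof (cases "{a, b} = {x, y}")
      case True
      then show ?thesis using xy by (auto simp: doubleton_eq_iff)
    next
      case False
      then have "{a, b} \<in> E'" using ab(2) xy(2) by blast
      then show ?thesis using ab(1) component_step by blast
    qed
  qed (simp add: component_refl)
  then show ?thesis
    using pivot_connected[OF assms] pivot_card[OF assms] pivot_subset_bipartite[OF assms] xy(1,2)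
    by (auto simp: two_trees_def)
qed

lemma path_alternates:
  assumes "E \<subseteq> bipartite_edges m n" "is_path E QNode v p" "k < length p"
  shows "if even k then p ! k \<in> right_nodes n else p ! k \<in> left_nodes m"
  using assms(3)
proof (induction k)
  case 0
  then show ?case using assms(2) by (auto simp: is_path_def hd_conv_nth right_nodes_def)
next
  case (Suc k)
  have "path_edge p (Suc k) \<in> E" using assms(2) Suc.prems by (auto simp: is_path_def)
  then have "{p ! k, p ! Suc k} \<in> bipartite_edges m n"
    using assms(1) by (auto simp: path_edge_def)
  then show ?case using Suc left_right_disjoint
    by (fastforce simp: bipartite_edges_def doubleton_eq_iff split: if_splits)
qed

text \<open>The nodes of a path are distinct, so deleting one edge leaves the part before it and the
  part after it intact.\<close>

lemma path_split:
  assumes "is_path E u v p" "1 \<le> k" "k < length p"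
  defines "E' \<equiv> E - {path_edge p k}"
  shows "p ! (k - 1) \<in> component E' u" "p ! k \<in> component E' v"
proof -
  have edge: "{p ! l, p ! Suc l} \<in> E'" if "Suc l < length p" "Suc l \<noteq> k" for l
  proof -
    have "path_edge p (Suc l) \<in> E" using assms(1) that by (auto simp: is_path_def)
    moreover have "path_edge p (Suc l) \<noteq> path_edge p k"
      using assms(1-3) that by (auto simp: is_path_def path_edge_def doubleton_eq_iff nth_eq_iff_index_eq)
    ultimately show ?thesis by (auto simp: E'_def path_edge_def)
  qed
  have "p ! l \<in> component E' u" if "l < k" for l
    using that
  proof (induction l)
    case 0
    then show ?case using assms(1) by (auto simp: is_path_def hd_conv_nth component_refl)
  next
    case (Suc l)
    then show ?case using edge[of l] assms(3) component_step by auto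
  qed
  then show "p ! (k - 1) \<in> component E' u" using assms(2) by simp
  have "k \<le> length p - 1" using assms(3) by simp
  then show "p ! k \<in> component E' v"
  proof (induction rule: inc_induct)
    case base
    then show ?case using assms(1) by (auto simp: is_path_def last_conv_nth component_refl)
  next
    case (step l)
    then have "{p ! Suc l, p ! l} \<in> E'" using edge[of l] by (simp add: insert_commute)
    then show ?case using step.IH component_step by blast
  qed
qed

text \<open>The path starts in the right node \<open>QNode\<close> and alternates, so an odd-numbered edge is traversed
  from its right end, still connected to \<open>QNode\<close> after the deletion, to its left end, still
  connected to \<open>PNode\<close>.\<close>

lemma transport_cycle_pivot:
  assumes "two_trees m n (edges s)" "transport_cycle m n c s s'"
  shows "\<exists>T. pivot m n (edges s) T (edges s')"
proof -
  from assms(2) obtain i j p e d l where cyc: "(i, j) \<in> contact_candidates m n s"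
    "is_path (edges (contact i j (descend d s))) QNode PNode p" "e \<in> odd_edges p"
    "s' = delete_edge e (readjust p l (contact i j (descend d s)))"
    unfolding transport_cycle_def Let_def by blast
  define T where "T = insert {ANode i, BNode j} (edges s)"
  have ij: "i \<in> {1..m}" "j \<in> {1..n}" "ANode i \<in> component (edges s) QNode"
    "BNode j \<in> component (edges s) PNode"
    using cyc(1) by (auto simp: contact_candidates_def moving_tree_def fixed_tree_def)
  have path: "is_path T QNode PNode p" and E': "edges s' = T - {e}"
    using cyc(2,4)
    by (simp_all add: T_def contact_def descend_def delete_edge_def readjust_def)
  obtain k where k: "1 \<le> k" "k < length p" "odd k" "e = path_edge p k"
    using cyc(3) by (auto simp: odd_edges_def)
  have bip: "T \<subseteq> bipartite_edges m n"
    using assms(1) bipartite_edgesI[OF ANode_left BNode_right, OF ij(1,2)]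
    by (simp add: T_def two_trees_def)
  have "p ! (k - 1) \<in> right_nodes n" "p ! k \<in> left_nodes m"
    using path_alternates[OF bip path, of "k - 1"] path_alternates[OF bip path, of k] k
    by auto
  moreover have "{p ! (k - 1), p ! k} \<in> T"
    using path k by (auto simp: is_path_def path_edge_def)
  moreover have "p ! (k - 1) \<in> component (edges s') QNode" "p ! k \<in> component (edges s') PNode"
    using path_split[OF path k(1,2)] E' k(4) by simp_all
  moreover have "edges s' = T - {{p ! (k - 1), p ! k}}"
    using E' k(4) by (simp add: path_edge_def)
  ultimately have "pivot m n (edges s) T (edges s')"
    unfolding pivot_def using ij T_def by blast
  then show ?thesis by blast
qed

lemma initial_two_trees:
  assumes "initial_state m n a b c s"
  shows "two_trees m n (edges s)"
proof -
  let ?EQ = "(\<lambda>i. {QNode, ANode i}) ` {1..m}" and ?EP = "(\<lambda>j. {PNode, BNode j}) ` {1..n}"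
  have E: "edges s = ?EQ \<union> ?EP"
    using assms by (auto simp: initial_state_def)
  have "card ?EQ = m" "card ?EP = n"
    by (simp_all add: card_image inj_on_def doubleton_eq_iff)
  moreover have "?EQ \<inter> ?EP = {}"
    by (auto simp: doubleton_eq_iff)
  ultimately have "card (edges s) = m + n"
    unfolding E by (subst card_Un_disjoint) auto
  moreover have "edges s \<subseteq> bipartite_edges m n"
    unfolding E bipartite_edges_def left_nodes_def right_nodes_def
    by (auto simp: doubleton_eq_iff)
  moreover have "left_nodes m \<union> right_nodes n \<subseteq> component (edges s) QNode \<union> component (edges s) PNode"
  proof -
    have "ANode i \<in> component (edges s) QNode" if "i \<in> {1..m}" for i
      using component_step[OF component_refl, of QNode "ANode i" "edges s"] that by (auto simp: E)
    moreover have "BNode j \<in> component (edges s) PNode" if "j \<in> {1..n}" for j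
      using component_step[OF component_refl, of PNode "BNode j" "edges s"] that by (auto simp: E)
    ultimately show ?thesis
      by (auto simp: left_nodes_def right_nodes_def component_refl)
  qed
  ultimately show ?thesis by (simp add: two_trees_def E)
qed

section \<open>Degree vectors do not recur\<close>

definition degree :: "node set set \<Rightarrow> node \<Rightarrow> nat" where
  "degree E v = card {e \<in> E. v \<in> e}"

lemma degree_mono: "finite F \<Longrightarrow> E \<subseteq> F \<Longrightarrow> degree E v \<le> degree F v"
  unfolding degree_def by (intro card_mono) auto

lemma degree_pos:
  assumes "finite E" "e \<in> E" "v \<in> e"
  shows "0 < degree E v"
  using assms by (auto simp: degree_def card_gt_0_iff)

lemma degree_insert:
  assumes "finite E" "e \<notin> E" "v \<in> e"
  shows "degree (insert e E) v = Suc (degree E v)"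
proof -
  have "{f \<in> insert e E. v \<in> f} = insert e {f \<in> E. v \<in> f}" using assms by auto
  then show ?thesis using assms by (simp add: degree_def)
qed

text \<open>The left end of the deleted edge falls into the fixed tree, hence it is not a node that stays in
  the moving tree.\<close>

lemma degree_pivot_delete:
  assumes "two_trees m n E'" "pivot m n E T E'" "ANode i \<in> component E' QNode"
  shows "degree E' (ANode i) = degree T (ANode i)"
proof -
  from assms(2) obtain x y where xy: "x \<in> right_nodes n" "E' = T - {{x, y}}"
    "y \<in> component E' PNode" by (auto simp: pivot_def)
  have "ANode i \<noteq> x" using xy(1) by (auto simp: right_nodes_def)
  moreover have "ANode i \<noteq> y" using xy(3) assms(3) two_trees_disjoint[OF assms(1)] by blast
  ultimately have "{e \<in> E'. ANode i \<in> e} = {e \<in> T. ANode i \<in> e}" using xy(2) by auto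
  then show ?thesis by (simp add: degree_def)
qed

text \<open>The key step. The set \<open>K\<close> in the proof is the part of the graph around \<open>QNode\<close> that survives from
  the deletion in cycle \<open>k\<close> up to cycle \<open>l\<close>; the last tree must have an edge that leaves it, and such
  an edge can only have been attached at a node \<open>ANode i\<close> of \<open>K\<close>.\<close>

lemma pivot_degree_less:
  assumes "\<And>t. t \<le> l \<Longrightarrow> two_trees m n (E t)"
    and "\<And>t. t \<le> l \<Longrightarrow> pivot m n (E t) (T t) (E (Suc t))"
    and "k < l"
  obtains i where "i \<in> {1..m}" "degree (T k) (ANode i) < degree (T l) (ANode i)"
proof -
  define K where "K = component (\<Inter>t\<in>{Suc k..l}. E t) QNode"
  have K: "K \<subseteq> component (E t) QNode" if "t \<in> {Suc k..l}" for t
    unfolding K_def using that by (intro component_mono) auto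
  have ET: "E t \<subseteq> T t" "E (Suc t) \<subseteq> T t" if "t \<le> l" for t
    using assms(2)[OF that] by (auto simp: pivot_def)
  have "PNode \<in> component (T l) QNode"
    using pivot_connected[OF assms(1,2), of l] by (auto simp: left_nodes_def)
  moreover have "PNode \<notin> K"
    using K[of l] two_trees_disjoint[OF assms(1), of l] assms(3) component_refl[of PNode] by fastforce
  ultimately obtain x y where xy: "x \<in> K" "y \<notin> K" "{x, y} \<in> T l"
    by (metis K_def component_exit component_refl)
  define A where "A = {t \<in> {Suc k..l}. {x, y} \<notin> E t}"
  have "A \<noteq> {}"
    using xy(1,2) component_step unfolding K_def A_def by blast
  \<comment> \<open>the last time at which the edge is absent, hence the time at which it is created\<close>
  define s where "s = Max A"
  have "finite A" by (simp add: A_def)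
  then have "s \<in> A" unfolding s_def using \<open>A \<noteq> {}\<close> by (rule Max_in)
  then have s: "s \<in> {Suc k..l}" "{x, y} \<notin> E s" by (auto simp: A_def)
  have "Suc s \<notin> A"
    using Max_ge[OF \<open>finite A\<close>, of "Suc s"] by (auto simp: s_def)
  have "{x, y} \<in> T s"
  proof (cases "s = l")
    case False
    then have "{x, y} \<in> E (Suc s)"
      using s \<open>Suc s \<notin> A\<close> by (auto simp: A_def)
    then show ?thesis using ET(2)[of s] s by auto
  qed (use xy in simp)
  moreover obtain i j where ij: "i \<in> {1..m}" "BNode j \<in> component (E s) PNode"
    "T s = insert {ANode i, BNode j} (E s)"
    using assms(2)[of s] s(1) by (auto simp: pivot_def)
  ultimately have e: "{x, y} = {ANode i, BNode j}" using s(2) by simp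
  moreover have "BNode j \<notin> K"
    using K[OF s(1)] ij(2) two_trees_disjoint[OF assms(1), of s] s(1) by fastforce
  ultimately have iK: "ANode i \<in> K"
    using xy(1) by (auto simp: doubleton_eq_iff)
  have fin: "finite (T t)" "finite (E t)" if "t \<le> l" for t
    using pivot_card[OF assms(1,2)[OF that]] assms(1)[OF that] that by (auto simp: two_trees_def)
  have eq: "degree (E (Suc t)) (ANode i) = degree (T t) (ANode i)" if "k \<le> t" "t < l" for t
    using that K[of "Suc t"] iK by (intro degree_pivot_delete[OF assms(1,2)]) auto
  have le: "degree (T t) (ANode i) \<le> degree (T (Suc t)) (ANode i)" if "k \<le> t" "t < l" for t
    using eq[OF that, symmetric] degree_mono[OF fin(1) ET(1), of "Suc t"] that by simp
  have mono: "degree (T t) (ANode i) \<le> degree (T t') (ANode i)" if "t \<le> t'" "k \<le> t" "t' \<le> l" for t t'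
    using that
  proof (induction rule: dec_induct)
    case (step u)
    then show ?case using le[of u] by simp
  qed simp
  obtain r where r: "s = Suc r" "k \<le> r" "r < l" using s(1) by (cases s) auto
  have "degree (T k) (ANode i) \<le> degree (E s) (ANode i)"
    using mono[of k r] eq[of r] r by simp
  also have "\<dots> < degree (T s) (ANode i)"
  proof -
    have "s \<le> l" "{ANode i, BNode j} \<notin> E s" using s e by simp_all
    then show ?thesis using degree_insert[OF fin(2), of s _ "ANode i"] ij(3) by simp
  qed
  also have "\<dots> \<le> degree (T l) (ANode i)"
    using mono[of s l] s(1) by simp
  finally show thesis using that ij(1) by blast
qed

section \<open>Counting degree vectors\<close>

text \<open>All left nodes have positive degree in a tree, so subtracting 1 loses no information; it turns
  the vector into a weak composition of \<open>n\<close>.\<close>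

definition degree_vector :: "nat \<Rightarrow> node set set \<Rightarrow> nat list" where
  "degree_vector m T = map (\<lambda>v. degree T v - 1) (map ANode [1..<Suc m] @ [PNode])"

lemma sum_degree_left:
  assumes "finite T" "T \<subseteq> bipartite_edges m n"
  shows "(\<Sum>v\<in>left_nodes m. degree T v) = card T"
proof -
  have fin: "finite (left_nodes m)" by (simp add: left_nodes_def)
  have "{e \<in> T. v \<in> e} \<inter> {e \<in> T. w \<in> e} = {}"
    if "v \<in> left_nodes m" "w \<in> left_nodes m" "v \<noteq> w" for v w
    using assms(2) that left_right_disjoint by (fastforce simp: bipartite_edges_def)
  then have "card (\<Union>v\<in>left_nodes m. {e \<in> T. v \<in> e}) = (\<Sum>v\<in>left_nodes m. degree T v)"
    unfolding degree_def using assms(1) fin by (intro card_UN_disjoint) auto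
  moreover have "(\<Union>v\<in>left_nodes m. {e \<in> T. v \<in> e}) = T"
    using assms(2) by (auto simp: bipartite_edges_def)
  ultimately show ?thesis by simp
qed

lemma pivot_degree_pos:
  assumes "two_trees m n E" "pivot m n E T E'" "v \<in> left_nodes m"
  shows "0 < degree T v"
proof -
  have "v \<in> component T QNode" using pivot_connected[OF assms(1,2)] assms(3) by blast
  then have "QNode \<in> component T v" by (rule component_sym)
  moreover have "QNode \<noteq> v" using assms(3) by (auto simp: left_nodes_def)
  ultimately obtain y where "{v, y} \<in> T"
    using component_exit[of QNode T v "{v}"] by blast
  then show ?thesis using degree_pos[OF pivot_card(1)[OF assms(1,2)]] by blast
qed

text \<open>Every edge is counted at its unique left end, and 1 is subtracted for each of the \<open>m + 1\<close> left
  nodes from a total of \<open>m + n + 1\<close>.\<close>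

lemma degree_vector_sum:
  assumes "two_trees m n E" "pivot m n E T E'"
  shows "sum_list (degree_vector m T) = n"
proof -
  let ?vs = "map ANode [1..<Suc m] @ [PNode]"
  have dist: "distinct ?vs" "set ?vs = left_nodes m"
    by (auto simp: left_nodes_def distinct_map inj_on_def)
  have "sum_list (degree_vector m T) = (\<Sum>v\<in>left_nodes m. degree T v - 1)"
    unfolding degree_vector_def using sum_list_distinct_conv_sum_set[OF dist(1)] dist(2) by metis
  moreover have "(\<Sum>v\<in>left_nodes m. degree T v) = (\<Sum>v\<in>left_nodes m. degree T v - 1) + card (left_nodes m)"
  proof -
    have "(\<Sum>v\<in>left_nodes m. degree T v) = (\<Sum>v\<in>left_nodes m. (degree T v - 1) + 1)"
      using pivot_degree_pos[OF assms] by (intro sum.cong) (auto simp: Suc_le_eq)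
    then show ?thesis by (simp add: sum_Suc)
  qed
  moreover have "card (left_nodes m) = m + 1"
    using distinct_card[OF dist(1)] dist(2) by simp
  ultimately show ?thesis
    using sum_degree_left[OF pivot_card(1)[OF assms] pivot_subset_bipartite[OF assms]]
      pivot_card(2)[OF assms] by simp
qed

lemma nth_degree_vector:
  assumes "i \<in> {1..m}"
  shows "degree_vector m T ! (i - 1) = degree T (ANode i) - 1"
  using assms by (auto simp: degree_vector_def nth_append simp del: upt_Suc)

text \<open>The node \<open>ANode i\<close> of the contact already had an edge, by which the moving tree reached it.\<close>

lemma degree_vector_not_extreme:
  assumes "two_trees m n E" "pivot m n E T E'"
  shows "degree_vector m T \<noteq> replicate m 0 @ [n]"
proof
  assume eq: "degree_vector m T = replicate m 0 @ [n]"
  obtain i j where ij: "i \<in> {1..m}" "ANode i \<in> component E QNode"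
    "T = insert {ANode i, BNode j} E" "{ANode i, BNode j} \<notin> E" by (rule pivot_contact[OF assms])
  have finE: "finite E" using assms(1) by (simp add: two_trees_def)
  have "degree T (ANode i) = Suc (degree E (ANode i))"
    using degree_insert[OF finE] ij(3,4) by simp
  moreover obtain y where "{ANode i, y} \<in> E"
    using component_exit[of QNode E "ANode i" "{ANode i}"] component_sym[OF ij(2)] by blast
  then have "0 < degree E (ANode i)" using degree_pos[OF finE] by blast
  ultimately have "degree_vector m T ! (i - 1) \<noteq> 0"
    using nth_degree_vector[OF ij(1)] by simp
  moreover have "degree_vector m T ! (i - 1) = 0"
    using ij(1) unfolding eq by (auto simp: nth_append)
  ultimately show False by simp
qed

lemma card_degree_vectors:
  "card ({xs :: nat list. length xs = Suc m \<and> sum_list xs = n} - {replicate m 0 @ [n]})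
     = ((m + n) choose m) - 1"
proof -
  have "card {xs :: nat list. length xs = Suc m \<and> sum_list xs = n} = (n + m) choose n"
    using card_length_sum_list[of "Suc m" n] by simp
  also have "\<dots> = (m + n) choose m"
    using binomial_symmetric[of m "m + n"] by (simp add: add.commute)
  finally show ?thesis
    by (subst card_Diff_singleton) (auto simp: sum_list_replicate)
qed

text \<open>By \<open>pivot_degree_less\<close> the trees have pairwise different degree vectors, and the vector with all
  \<open>ANode i\<close> of degree 1 is avoided.\<close>

lemma pivot_sequence_bound:
  assumes "two_trees m n (E 0)"
    and "\<And>t. t < N \<Longrightarrow> pivot m n (E t) (T t) (E (Suc t))"
  shows "N \<le> ((m + n) choose m) - 1"
proof -
  have tt: "two_trees m n (E t)" if "t \<le> N" for t
    using that
  proof (induction t)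
    case (Suc t)
    then show ?case using two_trees_pivot[OF _ assms(2), of t] by simp
  qed (rule assms(1))
  have ne: "degree_vector m (T k) \<noteq> degree_vector m (T l)" if "k < l" "l < N" for k l
  proof -
    have a: "two_trees m n (E t)" and b: "pivot m n (E t) (T t) (E (Suc t))" if "t \<le> l" for t
      using tt[of t] assms(2)[of t] that \<open>l < N\<close> by auto
    obtain i where i: "i \<in> {1..m}" "degree (T k) (ANode i) < degree (T l) (ANode i)"
      using pivot_degree_less[of l m n E T k, OF a b \<open>k < l\<close>] by blast
    have "0 < degree (T k) (ANode i)"
      using pivot_degree_pos[OF a b ANode_left[OF i(1)]] \<open>k < l\<close> by auto
    with i(2) have "degree (T k) (ANode i) - 1 \<noteq> degree (T l) (ANode i) - 1" by linarith
    then show ?thesis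
      using nth_degree_vector[OF i(1)] by metis
  qed
  have "inj_on (\<lambda>t. degree_vector m (T t)) {..<N}"
    using ne by (intro linorder_inj_onI) auto
  moreover have "(\<lambda>t. degree_vector m (T t)) ` {..<N} \<subseteq>
      {xs. length xs = Suc m \<and> sum_list xs = n} - {replicate m 0 @ [n]}" (is "_ \<subseteq> ?D")
  proof (intro image_subsetI)
    fix t assume "t \<in> {..<N}"
    then have "two_trees m n (E t)" "pivot m n (E t) (T t) (E (Suc t))"
      using tt assms(2) by auto
    then show "degree_vector m (T t) \<in> ?D"
      using degree_vector_sum degree_vector_not_extreme by (auto simp: degree_vector_def)
  qed
  moreover have "finite ?D"
  proof -
    have "{xs :: nat list. length xs = Suc m \<and> sum_list xs = n} \<subseteq>
        {xs. set xs \<subseteq> {..n} \<and> length xs = Suc m}"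
      using member_le_sum_list by fastforce
    then show ?thesis using finite_lists_length_eq[of "{..n}" "Suc m"] finite_subset by blast
  qed
  ultimately have "card {..<N} \<le> card ?D" by (rule card_inj_on_le)
  then show ?thesis using card_degree_vectors[of m n] by simp
qed

theorem mainTheorem4:
  fixes m n :: nat
  assumes "m \<ge> 1" and "n \<ge> 1"
  shows "Z m n \<le> enat (((m + n) choose m) - 1)"
  unfolding Z_def
proof (rule Sup_least, clarify)
  fix N a b c S
  assume ex: "execution m n a b c S N"
  \<comment> \<open>bounding every finite initial segment also excludes a run that never terminates\<close>
  have bound: "M \<le> ((m + n) choose m) - 1" if M: "enat M \<le> N" for M
  proof -
    have init: "two_trees m n (edges (S 0))"
      using ex initial_two_trees by (auto simp: execution_def)
    have cyc: "transport_cycle m n c (S t) (S (Suc t))" if "t < M" for t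
    proof -
      have "enat t < N" using that M by (meson enat_ord_simps(2) less_le_trans)
      then show ?thesis using ex by (simp add: execution_def)
    qed
    have tt: "two_trees m n (edges (S t))" if "t \<le> M" for t
      using that
    proof (induction t)
      case (Suc t)
      then show ?case using transport_cycle_pivot[OF _ cyc, of t] two_trees_pivot by auto
    qed (rule init)
    have "\<forall>t. \<exists>T. t < M \<longrightarrow> pivot m n (edges (S t)) T (edges (S (Suc t)))"
      using transport_cycle_pivot[OF tt cyc] by auto
    then obtain T where "\<And>t. t < M \<Longrightarrow> pivot m n (edges (S t)) (T t) (edges (S (Suc t)))"
      by metis
    then show ?thesis using pivot_sequence_bound[of m n "\<lambda>t. edges (S t)" M T] init by blast
  qed
  show "N \<le> enat (((m + n) choose m) - 1)"
  proof (cases N)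
    case (enat M)
    then show ?thesis using bound[of M] by simp
  next
    case infinity
    then show ?thesis using bound[of "Suc (((m + n) choose m) - 1)"] by (simp del: Suc_pred)
  qed
qed

end
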